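(* Let $\mathtt{K}$ be a category and $\mathtt{L}$ a class of objects of $\mathtt{K}$ such that: (i) $\mathtt{K}$ is projectively complete; (ii) $\mathtt{K}$ has nodal decomposition; (iii) $\mathtt{K}$ is co-well-powered in the class $\mathrm{Epi}$ of all epimorphisms; (iv) for every object $X$ of $\mathtt{K}$ there is a morphism $\varphi$ in $\mathtt{K}$ with $\mathrm{Dom}\,\varphi=X$ and $\mathrm{Ran}\,\varphi\in\mathtt{L}$; (v) $\mathtt{L}$ differs morphisms on the outside; (vi) $\mathtt{L}$ is closed with respect to passage to projective limits; (vii) $\mathtt{L}$ is closed with respect to passage from the range of a morphism to its nodal image: if $\mathrm{Ran}\,\alpha\in\mathtt{L}$, then $\mathrm{Im}_\infty\alpha\in\mathtt{L}$. Then: (a) each object $X$ of $\mathtt{K}$ has an envelope $\mathrm{env}_{\mathtt L}^{\mathtt L}X$ in the class of objects $\mathtt{L}$ with respect to the same class $\mathtt{L}$; (b) each envelope $\mathrm{env}_{\mathtt L}^{\mathtt L}X$ is a bimorphism; (c) the envelope $\mathrm{Env}_{\mathtt L}^{\mathtt L}$ can be defined as a functor.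
   Context: Set-theoretic foundation: Morse–Kelley class theory. $\mathrm{Dom}$, $\mathrm{Ran}$ denote domain and range; a bimorphism is a morphism that is both a monomorphism and an epimorphism. Projectively complete: every functor from a small category has a projective limit. Strong monomorphism: a monomorphism $\mu:C\to D$ such that for every epimorphism $\varepsilon:A\to B$ and all $\alpha:A\to C$, $\beta:B\to D$ with $\beta\circ\varepsilon=\mu\circ\alpha$ there is $\delta:B\to C$ with $\delta\circ\varepsilon=\alpha$, $\mu\circ\delta=\beta$. Strong epimorphism: dual notion. A nodal decomposition of $\varphi:X\to Y$ is a representation $\varphi=\mathrm{im}_\infty\varphi\circ\mathrm{red}_\infty\varphi\circ\mathrm{coim}_\infty\varphi$ with $\mathrm{coim}_\infty\varphi:X\to\mathrm{Coim}_\infty\varphi$ a strong epimorphism, $\mathrm{red}_\infty\varphi:\mathrm{Coim}_\infty\varphi\to\mathrm{Im}_\infty\varphi$ a bimorphism, $\mathrm{im}_\infty\varphi:\mathrm{Im}_\infty\varphi\to Y$ a strong monomorphism; it is unique up to isomorphism, and $\mathrm{Im}_\infty\varphi$ is called the nodal image of $\varphi$. $\mathtt{K}$ has nodal decomposition if every morphism has one. $\mathtt{K}$ is co-well-powered in $\mathrm{Epi}$ if for every object $X$ the category of epimorphisms with domain $X$ (morphisms from $\rho:X\to A$ to $\sigma:X\to B$ being $\varkappa:A\to B$ with $\varkappa\circ\rho=\sigma$) has a skeleton which is a set. $\mathtt{L}$ differs morphisms on the outside if for any two different parallel morphisms $\alpha\ne\beta:X\to Y$ there is a morphism $\varphi:Y\to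 M$ with $M\in\mathtt{L}$ and $\varphi\circ\alpha\ne\varphi\circ\beta$. Envelope: a morphism $\sigma:X\to X'$ is an extension of $X$ in $\mathtt{L}$ with respect to $\mathtt{L}$ if $X'\in\mathtt{L}$ and for every $B\in\mathtt{L}$ and every $\varphi:X\to B$ there is a unique $\varphi':X'\to B$ with $\varphi=\varphi'\circ\sigma$. An extension $\rho:X\to E$ is an envelope, $\rho=\mathrm{env}_{\mathtt L}^{\mathtt L}X$, $E=\mathrm{Env}_{\mathtt L}^{\mathtt L}X$, if for every extension $\sigma:X\to X'$ there is a unique $\upsilon:X'\to E$ with $\rho=\upsilon\circ\sigma$. "$\mathrm{Env}_{\mathtt L}^{\mathtt L}$ can be defined as a functor" means: there are a map assigning to each object $X$ an envelope $e_X:X\to E(X)$ of $X$ in $\mathtt{L}$ with respect to $\mathtt{L}$, and a map assigning to each morphism $\alpha:X\to Y$ a morphism $E(\alpha):E(X)\to E(Y)$ with $E(\alpha)\circ e_X=e_Y\circ\alpha$, such that $E(1_X)=1_{E(X)}$ and $E(\beta\circ\alpha)=E(\beta)\circ E(\alpha)$. *)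

theory Defs
  imports Main
begin

section \<open>Morse--Kelley class theory over a type\<close>

text \<open>
  The elements of the type \<open>'u\<close> are the sets, the relation \<open>mem\<close> is membership, and the classes
  are the values of type \<open>'u set\<close>. The classification axiom is comprehension of HOL,
  and the axiom of choice (for sets and for classes) follows from the choice operator of HOL, so
  neither is listed. The other axioms are those of Kelley's list. In \<open>substitution\<close> a total \<open>f\<close> is
  enough: a class function whose domain is a set extends to a total function.
\<close>

definition ext :: "('u \<Rightarrow> 'u \<Rightarrow> bool) \<Rightarrow> 'u \<Rightarrow> 'u set" where
  "ext mem a = {x. mem x a}"

definition is_set :: "('u \<Rightarrow> 'u \<Rightarrow> bool) \<Rightarrow> 'u set \<Rightarrow> bool" where
  "is_set mem A \<longleftrightarrow> (\<exists>a. A = ext mem a)"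

locale morse_kelley =
  fixes mem :: "'u \<Rightarrow> 'u \<Rightarrow> bool"
  assumes extent: "ext mem a = ext mem b \<Longrightarrow> a = b"
    and subsets: "\<exists>p. \<forall>A. A \<subseteq> ext mem x \<longrightarrow> (\<exists>z. mem z p \<and> ext mem z = A)"
    and union: "is_set mem (ext mem a \<union> ext mem b)"
    and substitution: "is_set mem (f ` ext mem a)"
    and amalgamation: "is_set mem (\<Union>y \<in> ext mem a. ext mem y)"
    and regularity: "A \<noteq> {} \<Longrightarrow> \<exists>x \<in> A. ext mem x \<inter> A = {}"
    and infinity: "\<exists>w. (\<exists>e. mem e w \<and> ext mem e = {}) \<and>
                       (\<forall>x. mem x w \<longrightarrow> (\<exists>s. mem s w \<and> ext mem s = insert x (ext mem x)))"


section \<open>Categories, functors, projective limits\<close>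

record ('o, 'm) cat =
  Obj :: "'o set"
  Mor :: "'m set"
  Dom :: "'m \<Rightarrow> 'o"
  Ran :: "'m \<Rightarrow> 'o"
  Ide :: "'o \<Rightarrow> 'm"
  Cmp :: "'m \<Rightarrow> 'm \<Rightarrow> 'm"  (infixl "\<cdot>\<index>" 70)

definition hom :: "('o, 'm, 'x) cat_scheme \<Rightarrow> 'o \<Rightarrow> 'o \<Rightarrow> 'm set" where
  "hom K X Y = {f \<in> Mor K. Dom K f = X \<and> Ran K f = Y}"

locale category =
  fixes K :: "('o, 'm, 'x) cat_scheme" (structure)
  assumes Dom_Obj: "f \<in> Mor K \<Longrightarrow> Dom K f \<in> Obj K"
    and Ran_Obj: "f \<in> Mor K \<Longrightarrow> Ran K f \<in> Obj K"
    and Ide_hom: "X \<in> Obj K \<Longrightarrow> Ide K X \<in> hom K X X"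
    and Cmp_hom: "f \<in> hom K X Y \<Longrightarrow> g \<in> hom K Y Z \<Longrightarrow> g \<cdot> f \<in> hom K X Z"
    and Cmp_Ide: "f \<in> hom K X Y \<Longrightarrow> f \<cdot> Ide K X = f"
    and Ide_Cmp: "f \<in> hom K X Y \<Longrightarrow> Ide K Y \<cdot> f = f"
    and Cmp_assoc: "f \<in> hom K W X \<Longrightarrow> g \<in> hom K X Y \<Longrightarrow> h \<in> hom K Y Z \<Longrightarrow>
                    h \<cdot> (g \<cdot> f) = (h \<cdot> g) \<cdot> f"

definition small_category :: "('u \<Rightarrow> 'u \<Rightarrow> bool) \<Rightarrow> ('u, 'u) cat \<Rightarrow> bool" where
  "small_category mem J \<longleftrightarrow> category J \<and> is_set mem (Obj J) \<and> is_set mem (Mor J)"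

definition is_functor ::
  "('o, 'm, 'x) cat_scheme \<Rightarrow> ('p, 'n, 'y) cat_scheme \<Rightarrow> ('o \<Rightarrow> 'p) \<Rightarrow> ('m \<Rightarrow> 'n) \<Rightarrow> bool" where
  "is_functor J K Fo Fm \<longleftrightarrow>
     (\<forall>X \<in> Obj J. Fo X \<in> Obj K) \<and>
     (\<forall>X \<in> Obj J. \<forall>Y \<in> Obj J. \<forall>f \<in> hom J X Y. Fm f \<in> hom K (Fo X) (Fo Y)) \<and>
     (\<forall>X \<in> Obj J. Fm (Ide J X) = Ide K (Fo X)) \<and>
     (\<forall>X \<in> Obj J. \<forall>Y \<in> Obj J. \<forall>Z \<in> Obj J. \<forall>f \<in> hom J X Y. \<forall>g \<in> hom J Y Z.
        Fm (g \<cdot>\<^bsub>J\<^esub> f) = Fm g \<cdot>\<^bsub>K\<^esub> Fm f)"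

definition is_cone ::
  "('o, 'm, 'x) cat_scheme \<Rightarrow> ('p, 'n, 'y) cat_scheme \<Rightarrow> ('o \<Rightarrow> 'p) \<Rightarrow> ('m \<Rightarrow> 'n) \<Rightarrow>
   'p \<Rightarrow> ('o \<Rightarrow> 'n) \<Rightarrow> bool" where
  "is_cone J K Fo Fm P p \<longleftrightarrow>
     P \<in> Obj K \<and>
     (\<forall>j \<in> Obj J. p j \<in> hom K P (Fo j)) \<and>
     (\<forall>j \<in> Obj J. \<forall>k \<in> Obj J. \<forall>u \<in> hom J j k. Fm u \<cdot>\<^bsub>K\<^esub> p j = p k)"

definition is_projective_limit ::
  "('o, 'm, 'x) cat_scheme \<Rightarrow> ('p, 'n, 'y) cat_scheme \<Rightarrow> ('o \<Rightarrow> 'p) \<Rightarrow> ('m \<Rightarrow> 'n) \<Rightarrow>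
   'p \<Rightarrow> ('o \<Rightarrow> 'n) \<Rightarrow> bool" where
  "is_projective_limit J K Fo Fm P p \<longleftrightarrow>
     is_cone J K Fo Fm P p \<and>
     (\<forall>Q q. is_cone J K Fo Fm Q q \<longrightarrow>
        (\<exists>!h. h \<in> hom K Q P \<and> (\<forall>j \<in> Obj J. p j \<cdot>\<^bsub>K\<^esub> h = q j)))"

definition projectively_complete :: "('u \<Rightarrow> 'u \<Rightarrow> bool) \<Rightarrow> ('u, 'u) cat \<Rightarrow> bool" where
  "projectively_complete mem K \<longleftrightarrow>
     (\<forall>J Fo Fm. small_category mem J \<longrightarrow> is_functor J K Fo Fm \<longrightarrow>
        (\<exists>P p. is_projective_limit J K Fo Fm P p))"

definition closed_under_projective_limits ::
  "('u \<Rightarrow> 'u \<Rightarrow> bool) \<Rightarrow> ('u, 'u) cat \<Rightarrow> 'u set \<Rightarrow> bool" where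
  "closed_under_projective_limits mem K L \<longleftrightarrow>
     (\<forall>J Fo Fm P p. small_category mem J \<longrightarrow> is_functor J K Fo Fm \<longrightarrow>
        (\<forall>j \<in> Obj J. Fo j \<in> L) \<longrightarrow> is_projective_limit J K Fo Fm P p \<longrightarrow> P \<in> L)"


section \<open>Classes of morphisms and the nodal decomposition\<close>

definition monomorphism :: "('o, 'm, 'x) cat_scheme \<Rightarrow> 'm \<Rightarrow> bool" where
  "monomorphism K \<mu> \<longleftrightarrow> \<mu> \<in> Mor K \<and>
     (\<forall>A \<in> Obj K. \<forall>\<alpha> \<in> hom K A (Dom K \<mu>). \<forall>\<beta> \<in> hom K A (Dom K \<mu>).
        \<mu> \<cdot>\<^bsub>K\<^esub> \<alpha> = \<mu> \<cdot>\<^bsub>K\<^esub> \<beta> \<longrightarrow> \<alpha> = \<beta>)"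

definition epimorphism :: "('o, 'm, 'x) cat_scheme \<Rightarrow> 'm \<Rightarrow> bool" where
  "epimorphism K \<epsilon> \<longleftrightarrow> \<epsilon> \<in> Mor K \<and>
     (\<forall>A \<in> Obj K. \<forall>\<alpha> \<in> hom K (Ran K \<epsilon>) A. \<forall>\<beta> \<in> hom K (Ran K \<epsilon>) A.
        \<alpha> \<cdot>\<^bsub>K\<^esub> \<epsilon> = \<beta> \<cdot>\<^bsub>K\<^esub> \<epsilon> \<longrightarrow> \<alpha> = \<beta>)"

definition bimorphism :: "('o, 'm, 'x) cat_scheme \<Rightarrow> 'm \<Rightarrow> bool" where
  "bimorphism K \<phi> \<longleftrightarrow> monomorphism K \<phi> \<and> epimorphism K \<phi>"

definition strong_mono :: "('o, 'm, 'x) cat_scheme \<Rightarrow> 'm \<Rightarrow> bool" where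
  "strong_mono K \<mu> \<longleftrightarrow> monomorphism K \<mu> \<and>
     (\<forall>\<epsilon> \<alpha> \<beta>. epimorphism K \<epsilon> \<longrightarrow>
        \<alpha> \<in> hom K (Dom K \<epsilon>) (Dom K \<mu>) \<longrightarrow> \<beta> \<in> hom K (Ran K \<epsilon>) (Ran K \<mu>) \<longrightarrow>
        \<beta> \<cdot>\<^bsub>K\<^esub> \<epsilon> = \<mu> \<cdot>\<^bsub>K\<^esub> \<alpha> \<longrightarrow>
        (\<exists>\<delta> \<in> hom K (Ran K \<epsilon>) (Dom K \<mu>). \<delta> \<cdot>\<^bsub>K\<^esub> \<epsilon> = \<alpha> \<and> \<mu> \<cdot>\<^bsub>K\<^esub> \<delta> = \<beta>))"

definition strong_epi :: "('o, 'm, 'x) cat_scheme \<Rightarrow> 'm \<Rightarrow> bool" where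
  "strong_epi K \<epsilon> \<longleftrightarrow> epimorphism K \<epsilon> \<and>
     (\<forall>\<mu> \<alpha> \<beta>. monomorphism K \<mu> \<longrightarrow>
        \<alpha> \<in> hom K (Dom K \<epsilon>) (Dom K \<mu>) \<longrightarrow> \<beta> \<in> hom K (Ran K \<epsilon>) (Ran K \<mu>) \<longrightarrow>
        \<beta> \<cdot>\<^bsub>K\<^esub> \<epsilon> = \<mu> \<cdot>\<^bsub>K\<^esub> \<alpha> \<longrightarrow>
        (\<exists>\<delta> \<in> hom K (Ran K \<epsilon>) (Dom K \<mu>). \<delta> \<cdot>\<^bsub>K\<^esub> \<epsilon> = \<alpha> \<and> \<mu> \<cdot>\<^bsub>K\<^esub> \<delta> = \<beta>))"

text \<open>The arguments \<open>i\<close>, \<open>r\<close>, \<open>c\<close> are \<open>im\<close>, \<open>red\<close>, \<open>coim\<close>; the nodal image is \<open>Dom K i\<close>.\<close>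

definition nodal_decomposition ::
  "('o, 'm, 'x) cat_scheme \<Rightarrow> 'm \<Rightarrow> 'm \<Rightarrow> 'm \<Rightarrow> 'm \<Rightarrow> bool" where
  "nodal_decomposition K \<phi> i r c \<longleftrightarrow>
     strong_epi K c \<and> bimorphism K r \<and> strong_mono K i \<and>
     Dom K c = Dom K \<phi> \<and> Ran K c = Dom K r \<and> Ran K r = Dom K i \<and> Ran K i = Ran K \<phi> \<and>
     \<phi> = i \<cdot>\<^bsub>K\<^esub> (r \<cdot>\<^bsub>K\<^esub> c)"

definition has_nodal_decomposition :: "('o, 'm, 'x) cat_scheme \<Rightarrow> bool" where
  "has_nodal_decomposition K \<longleftrightarrow> (\<forall>\<phi> \<in> Mor K. \<exists>i r c. nodal_decomposition K \<phi> i r c)"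

text \<open>The nodal image is determined up to isomorphism only; closedness refers to each of them.\<close>

definition closed_under_nodal_images :: "('o, 'm, 'x) cat_scheme \<Rightarrow> 'o set \<Rightarrow> bool" where
  "closed_under_nodal_images K L \<longleftrightarrow>
     (\<forall>\<alpha> \<in> Mor K. Ran K \<alpha> \<in> L \<longrightarrow> (\<forall>i r c. nodal_decomposition K \<alpha> i r c \<longrightarrow> Dom K i \<in> L))"


section \<open>Co-well-poweredness and separation of morphisms\<close>

text \<open>
  The epimorphisms with domain \<open>X\<close>. A morphism is a triple \<open>(\<rho>, \<kappa>, \<sigma>)\<close>, so that it carries its
  domain and range.
\<close>

definition epi_category ::
  "('o, 'm, 'x) cat_scheme \<Rightarrow> 'o \<Rightarrow> ('m, 'm \<times> 'm \<times> 'm) cat" where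
  "epi_category K X =
     \<lparr> Obj = {\<rho>. epimorphism K \<rho> \<and> Dom K \<rho> = X},
       Mor = {(\<rho>, \<kappa>, \<sigma>). epimorphism K \<rho> \<and> Dom K \<rho> = X \<and> epimorphism K \<sigma> \<and> Dom K \<sigma> = X \<and>
                         \<kappa> \<in> hom K (Ran K \<rho>) (Ran K \<sigma>) \<and> \<kappa> \<cdot>\<^bsub>K\<^esub> \<rho> = \<sigma>},
       Dom = (\<lambda>(\<rho>, \<kappa>, \<sigma>). \<rho>),
       Ran = (\<lambda>(\<rho>, \<kappa>, \<sigma>). \<sigma>),
       Ide = (\<lambda>\<rho>. (\<rho>, Ide K (Ran K \<rho>), \<rho>)),
       Cmp = (\<lambda>(\<sigma>', \<kappa>', \<tau>) (\<rho>, \<kappa>, \<sigma>). (\<rho>, \<kappa>' \<cdot>\<^bsub>K\<^esub> \<kappa>, \<tau>)) \<rparr>"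

definition isomorphic :: "('o, 'm, 'x) cat_scheme \<Rightarrow> 'o \<Rightarrow> 'o \<Rightarrow> bool" where
  "isomorphic K X Y \<longleftrightarrow>
     (\<exists>f \<in> hom K X Y. \<exists>g \<in> hom K Y X. g \<cdot>\<^bsub>K\<^esub> f = Ide K X \<and> f \<cdot>\<^bsub>K\<^esub> g = Ide K Y)"

text \<open>A skeleton is a full subcategory, so it is given by its class of objects.\<close>

definition skeleton :: "('o, 'm, 'x) cat_scheme \<Rightarrow> 'o set \<Rightarrow> bool" where
  "skeleton C S \<longleftrightarrow> S \<subseteq> Obj C \<and> (\<forall>X \<in> Obj C. \<exists>!s. s \<in> S \<and> isomorphic C X s)"

text \<open>
  It is enough to require the objects of the skeleton to form a set: between two objects of
  \<^const>\<open>epi_category\<close> there is at most one morphism, because \<open>\<kappa> \<circ> \<rho> = \<sigma>\<close> determines \<open>\<kappa>\<close> when \<open>\<rho>\<close>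
  is an epimorphism.
\<close>

definition co_well_powered_in_Epi :: "('u \<Rightarrow> 'u \<Rightarrow> bool) \<Rightarrow> ('u, 'u) cat \<Rightarrow> bool" where
  "co_well_powered_in_Epi mem K \<longleftrightarrow>
     (\<forall>X \<in> Obj K. \<exists>S. skeleton (epi_category K X) S \<and> is_set mem S)"

definition differs_morphisms_outside :: "('o, 'm, 'x) cat_scheme \<Rightarrow> 'o set \<Rightarrow> bool" where
  "differs_morphisms_outside K L \<longleftrightarrow>
     (\<forall>X \<in> Obj K. \<forall>Y \<in> Obj K. \<forall>\<alpha> \<in> hom K X Y. \<forall>\<beta> \<in> hom K X Y. \<alpha> \<noteq> \<beta> \<longrightarrow>
        (\<exists>M \<in> L. \<exists>\<phi> \<in> hom K Y M. \<phi> \<cdot>\<^bsub>K\<^esub> \<alpha> \<noteq> \<phi> \<cdot>\<^bsub>K\<^esub> \<beta>))"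


section \<open>Envelopes\<close>

text \<open>
  \<open>is_extension K L M X \<sigma>\<close>: \<open>\<sigma>\<close> is an extension of \<open>X\<close> in the class of objects \<open>L\<close> with respect to
  the class of objects \<open>M\<close>; likewise for envelopes.
\<close>

definition is_extension ::
  "('o, 'm, 'x) cat_scheme \<Rightarrow> 'o set \<Rightarrow> 'o set \<Rightarrow> 'o \<Rightarrow> 'm \<Rightarrow> bool" where
  "is_extension K L M X \<sigma> \<longleftrightarrow>
     \<sigma> \<in> Mor K \<and> Dom K \<sigma> = X \<and> Ran K \<sigma> \<in> L \<and>
     (\<forall>B \<in> M. \<forall>\<phi> \<in> hom K X B. \<exists>!\<phi>'. \<phi>' \<in> hom K (Ran K \<sigma>) B \<and> \<phi> = \<phi>' \<cdot>\<^bsub>K\<^esub> \<sigma>)"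

definition is_envelope ::
  "('o, 'm, 'x) cat_scheme \<Rightarrow> 'o set \<Rightarrow> 'o set \<Rightarrow> 'o \<Rightarrow> 'm \<Rightarrow> bool" where
  "is_envelope K L M X \<rho> \<longleftrightarrow>
     is_extension K L M X \<rho> \<and>
     (\<forall>\<sigma>. is_extension K L M X \<sigma> \<longrightarrow>
        (\<exists>!\<upsilon>. \<upsilon> \<in> hom K (Ran K \<sigma>) (Ran K \<rho>) \<and> \<rho> = \<upsilon> \<cdot>\<^bsub>K\<^esub> \<sigma>))"

definition envelope_is_functor ::
  "('o, 'm, 'x) cat_scheme \<Rightarrow> 'o set \<Rightarrow> 'o set \<Rightarrow> bool" where
  "envelope_is_functor K L M \<longleftrightarrow>
     (\<exists>Eo Em e. is_functor K K Eo Em \<and>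
        (\<forall>X \<in> Obj K. e X \<in> hom K X (Eo X) \<and> is_envelope K L M X (e X)) \<and>
        (\<forall>X \<in> Obj K. \<forall>Y \<in> Obj K. \<forall>\<alpha> \<in> hom K X Y. Em \<alpha> \<cdot>\<^bsub>K\<^esub> e X = e Y \<cdot>\<^bsub>K\<^esub> \<alpha>))"


section \<open>The category of epimorphisms\<close>

lemma hom_epi_category:
  "F \<in> hom (epi_category K X) \<rho> \<sigma> \<longleftrightarrow>
     (\<exists>\<kappa>. F = (\<rho>, \<kappa>, \<sigma>) \<and> epimorphism K \<rho> \<and> Dom K \<rho> = X \<and> epimorphism K \<sigma> \<and> Dom K \<sigma> = X \<and>
          \<kappa> \<in> hom K (Ran K \<rho>) (Ran K \<sigma>) \<and> Cmp K \<kappa> \<rho> = \<sigma>)"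
  unfolding hom_def[where K = "epi_category K X"]
  by (cases F) (auto simp: epi_category_def)

lemma epi_category_thin:
  assumes "category K" "f \<in> hom (epi_category K X) \<rho> \<sigma>" "g \<in> hom (epi_category K X) \<rho> \<sigma>"
  shows "f = g"
proof -
  interpret category K by fact
  from assms(2) obtain \<kappa> where f: "f = (\<rho>, \<kappa>, \<sigma>)" "epimorphism K \<rho>"
    "\<kappa> \<in> hom K (Ran K \<rho>) (Ran K \<sigma>)" "Cmp K \<kappa> \<rho> = \<sigma>"
    by (auto simp: hom_epi_category)
  from assms(3) obtain \<kappa>' where g: "g = (\<rho>, \<kappa>', \<sigma>)"
    "\<kappa>' \<in> hom K (Ran K \<rho>) (Ran K \<sigma>)" "Cmp K \<kappa>' \<rho> = \<sigma>"
    by (auto simp: hom_epi_category)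
  have "Ran K \<sigma> \<in> Obj K" using f(3) Ran_Obj[of \<kappa>] by (simp add: hom_def)
  with f g have "\<kappa> = \<kappa>'" by (auto simp: epimorphism_def)
  with f g show ?thesis by simp
qed

lemma category_epi_category:
  assumes "category K"
  shows "category (epi_category K X)"
proof -
  interpret category K by fact
  have Cmp_E: "Cmp (epi_category K Z) (\<sigma>', \<kappa>', \<tau>) (\<rho>, \<kappa>, \<sigma>) = (\<rho>, Cmp K \<kappa>' \<kappa>, \<tau>)" for Z \<sigma>' \<kappa>' \<tau> \<rho> \<kappa> \<sigma>
    by (simp add: epi_category_def)
  have Ide_E: "Ide (epi_category K Z) \<rho> = (\<rho>, Ide K (Ran K \<rho>), \<rho>)" for Z \<rho>
    by (simp add: epi_category_def)
  have epi_hom: "epimorphism K \<rho> \<Longrightarrow> \<rho> \<in> hom K (Dom K \<rho>) (Ran K \<rho>)" for \<rho>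
    by (simp add: epimorphism_def hom_def)
  have epi_Ran: "epimorphism K \<rho> \<Longrightarrow> Ran K \<rho> \<in> Obj K" for \<rho>
    by (simp add: epimorphism_def Ran_Obj)
  show ?thesis
  proof
    fix F assume "F \<in> Mor (epi_category K X)"
    then show "Dom (epi_category K X) F \<in> Obj (epi_category K X)"
      and "Ran (epi_category K X) F \<in> Obj (epi_category K X)"
      by (auto simp: epi_category_def)
  next
    fix \<rho> assume "\<rho> \<in> Obj (epi_category K X)"
    then have "epimorphism K \<rho>" "Dom K \<rho> = X" by (auto simp: epi_category_def)
    then show "Ide (epi_category K X) \<rho> \<in> hom (epi_category K X) \<rho> \<rho>"
      using Ide_hom[OF epi_Ran] Ide_Cmp[OF epi_hom] by (simp add: hom_epi_category Ide_E)
  next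
    fix F G \<rho> \<sigma> \<tau>
    assume "F \<in> hom (epi_category K X) \<rho> \<sigma>" "G \<in> hom (epi_category K X) \<sigma> \<tau>"
    then obtain \<kappa> \<kappa>' where
      F: "F = (\<rho>, \<kappa>, \<sigma>)" "epimorphism K \<rho>" "Dom K \<rho> = X" "\<kappa> \<in> hom K (Ran K \<rho>) (Ran K \<sigma>)"
         "Cmp K \<kappa> \<rho> = \<sigma>" and
      G: "G = (\<sigma>, \<kappa>', \<tau>)" "epimorphism K \<tau>" "Dom K \<tau> = X" "\<kappa>' \<in> hom K (Ran K \<sigma>) (Ran K \<tau>)"
         "Cmp K \<kappa>' \<sigma> = \<tau>"
      by (auto simp: hom_epi_category)
    have "Cmp K (Cmp K \<kappa>' \<kappa>) \<rho> = \<tau>"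
      using Cmp_assoc[OF epi_hom[OF F(2)] F(4) G(4)] F(5) G(5) by simp
    then show "Cmp (epi_category K X) G F \<in> hom (epi_category K X) \<rho> \<tau>"
      using F G Cmp_hom[OF F(4) G(4)] by (simp add: hom_epi_category Cmp_E)
  next
    fix F \<rho> \<sigma> assume "F \<in> hom (epi_category K X) \<rho> \<sigma>"
    then show "Cmp (epi_category K X) F (Ide (epi_category K X) \<rho>) = F"
      and "Cmp (epi_category K X) (Ide (epi_category K X) \<sigma>) F = F"
      using Cmp_Ide Ide_Cmp by (auto simp: hom_epi_category Cmp_E Ide_E)
  next
    fix F G H \<rho> \<sigma> \<tau> \<omega>
    assume "F \<in> hom (epi_category K X) \<rho> \<sigma>" "G \<in> hom (epi_category K X) \<sigma> \<tau>"
      "H \<in> hom (epi_category K X) \<tau> \<omega>"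
    then show "Cmp (epi_category K X) H (Cmp (epi_category K X) G F) =
               Cmp (epi_category K X) (Cmp (epi_category K X) H G) F"
      using Cmp_assoc by (auto simp: hom_epi_category Cmp_E)
  qed
qed

end

theory Submission
  imports Defs
begin

text \<open>
  Since the range of an envelope lies in \<open>L\<close>, envelopes in \<open>L\<close> with respect to \<open>L\<close> are the same as
  extensions, that is, as reflections into \<open>L\<close>. A reflection of \<open>X\<close> is obtained as in Freyd's
  adjoint functor theorem. The nodal decomposition factors every morphism from \<open>X\<close> to an object of
  \<open>L\<close> through an epimorphism with range in \<open>L\<close>, and by co-well-poweredness a set of such
  epimorphisms suffices. Their joint morphism into the product of their ranges has a nodal
  decomposition \<open>i \<circ> r \<circ> c\<close>, and \<open>r \<circ> c\<close> is the reflection: existence of factorizations comes from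
  the product, uniqueness from \<open>r \<circ> c\<close> being epic.
\<close>

section \<open>Sets and discrete index categories\<close>

lemma (in morse_kelley) is_set_subset:
  assumes "is_set mem A" "B \<subseteq> A"
  shows "is_set mem B"
proof -
  obtain a where a: "A = ext mem a" using assms(1) unfolding is_set_def by blast
  obtain p where "\<forall>A. A \<subseteq> ext mem a \<longrightarrow> (\<exists>z. mem z p \<and> ext mem z = A)"
    using subsets by blast
  then obtain z where "ext mem z = B" using assms(2) a by blast
  then show ?thesis unfolding is_set_def by blast
qed

text \<open>The index category for products over \<open>I\<close>. Each object serves as its own
  identity; \<open>Cmp\<close> may return its left argument because only equal elements are
  composable.\<close>

definition discrete_category :: "'u set \<Rightarrow> ('u, 'u) cat" where
  "discrete_category I =
     \<lparr> Obj = I, Mor = I, Dom = (\<lambda>x. x), Ran = (\<lambda>x. x), Ide = (\<lambda>x. x), Cmp = (\<lambda>x y. x) \<rparr>"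

lemma discrete_category_simps:
  "Obj (discrete_category I) = I"
  "Ide (discrete_category I) j = j"
  "f \<cdot>\<^bsub>discrete_category I\<^esub> g = f"
  by (simp_all add: discrete_category_def)

lemma hom_discrete_category: "f \<in> hom (discrete_category I) j k \<longleftrightarrow> f \<in> I \<and> j = f \<and> k = f"
  by (auto simp: hom_def discrete_category_def)

lemma small_discrete_category: "is_set mem I \<Longrightarrow> small_category mem (discrete_category I)"
  unfolding small_category_def category_def hom_discrete_category
  by (auto simp: discrete_category_def)

section \<open>Epimorphisms and factorization through them\<close>

context category
begin

lemma hom_Obj:
  assumes "f \<in> hom K X Y"
  shows "X \<in> Obj K" "Y \<in> Obj K"
  using assms Dom_Obj Ran_Obj by (auto simp: hom_def)

lemma epimorphismD:
  assumes "epimorphism K e" "e \<in> hom K X Y" "a \<in> hom K Y Z" "b \<in> hom K Y Z" "a \<cdot> e = b \<cdot> e"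
  shows "a = b"
  using assms hom_Obj[OF assms(3)] by (auto simp: epimorphism_def hom_def)

lemma epimorphism_Cmp:
  assumes "epimorphism K e" "epimorphism K f" "e \<in> hom K X Y" "f \<in> hom K Y Z"
  shows "epimorphism K (f \<cdot> e)"
proof -
  have fe: "f \<cdot> e \<in> hom K X Z" using assms Cmp_hom by blast
  have "a = b" if "a \<in> hom K Z A" "b \<in> hom K Z A" "a \<cdot> (f \<cdot> e) = b \<cdot> (f \<cdot> e)" for A a b
  proof -
    have "(a \<cdot> f) \<cdot> e = (b \<cdot> f) \<cdot> e"
      using that(3) Cmp_assoc[OF assms(3,4) that(1)] Cmp_assoc[OF assms(3,4) that(2)] by simp
    then have "a \<cdot> f = b \<cdot> f"
      by (rule epimorphismD[OF assms(1,3) Cmp_hom[OF assms(4) that(1)] Cmp_hom[OF assms(4) that(2)]])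
    then show ?thesis by (rule epimorphismD[OF assms(2,4) that(1,2)])
  qed
  then show ?thesis using fe unfolding epimorphism_def by (auto simp: hom_def)
qed

text \<open>Take \<open>e = r \<cdot> c\<close>, a composite of epimorphisms, and
  \<open>m = i\<close>. The middle object is then the nodal image, which stays in \<open>L\<close>
  because \<open>B\<close> is in \<open>L\<close>.\<close>

lemma nodal_epi_factorization:
  assumes "has_nodal_decomposition K" "closed_under_nodal_images K L"
    and \<phi>: "\<phi> \<in> hom K X B" "B \<in> L"
  obtains E e m where "E \<in> L" "epimorphism K e" "e \<in> hom K X E" "m \<in> hom K E B" "m \<cdot> e = \<phi>"
proof -
  have M: "\<phi> \<in> Mor K" "Dom K \<phi> = X" "Ran K \<phi> = B" using \<phi> by (auto simp: hom_def)
  obtain i r c where n: "nodal_decomposition K \<phi> i r c"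
    using assms(1) M unfolding has_nodal_decomposition_def by blast
  have c: "epimorphism K c" "c \<in> hom K X (Dom K r)"
    using n M by (auto simp: nodal_decomposition_def strong_epi_def epimorphism_def hom_def)
  have r: "epimorphism K r" "r \<in> hom K (Dom K r) (Dom K i)"
    using n by (auto simp: nodal_decomposition_def bimorphism_def epimorphism_def hom_def)
  have i: "i \<in> hom K (Dom K i) B"
    using n M by (auto simp: nodal_decomposition_def strong_mono_def monomorphism_def hom_def)
  have "Dom K i \<in> L"
    using assms(2) M \<phi> n unfolding closed_under_nodal_images_def by blast
  moreover have "\<phi> = i \<cdot> (r \<cdot> c)" using n by (simp add: nodal_decomposition_def)
  ultimately show ?thesis
    using that epimorphism_Cmp[OF c(1) r(1) c(2) r(2)] Cmp_hom[OF c(2) r(2)] i by blast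
qed

lemma isomorphic_epi_category_factor:
  assumes "isomorphic (epi_category K X) \<rho> \<sigma>"
  obtains \<kappa> \<kappa>' where "\<kappa> \<in> hom K (Ran K \<rho>) (Ran K \<sigma>)" "\<kappa> \<cdot> \<rho> = \<sigma>"
    "\<kappa>' \<in> hom K (Ran K \<sigma>) (Ran K \<rho>)" "\<kappa>' \<cdot> \<sigma> = \<rho>"
  using assms that by (fastforce simp: isomorphic_def hom_epi_category)

section \<open>Extensions and envelopes\<close>

lemma extension_hom: "is_extension K L M X \<sigma> \<Longrightarrow> \<sigma> \<in> hom K X (Ran K \<sigma>)"
  by (simp add: is_extension_def hom_def)

text \<open>The range of \<open>\<rho>\<close> lies in \<open>L\<close>, so \<open>\<rho>\<close> is
  itself one of the test morphisms that every extension \<open>\<sigma>\<close> factors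
  uniquely.\<close>

lemma extension_is_envelope:
  assumes "is_extension K L L X \<rho>"
  shows "is_envelope K L L X \<rho>"
  unfolding is_envelope_def
proof (intro conjI allI impI)
  fix \<sigma> assume "is_extension K L L X \<sigma>"
  then have "\<forall>B \<in> L. \<forall>\<phi> \<in> hom K X B. \<exists>!\<psi>. \<psi> \<in> hom K (Ran K \<sigma>) B \<and> \<phi> = \<psi> \<cdot> \<sigma>"
    by (simp add: is_extension_def)
  moreover have "Ran K \<rho> \<in> L" using assms by (simp add: is_extension_def)
  ultimately show "\<exists>!\<psi>. \<psi> \<in> hom K (Ran K \<sigma>) (Ran K \<rho>) \<and> \<rho> = \<psi> \<cdot> \<sigma>"
    using extension_hom[OF assms] by simp
qed (fact assms)

lemma epi_is_extension:
  assumes "epimorphism K \<rho>" "\<rho> \<in> hom K X E" "E \<in> L"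
    and "\<And>B \<phi>. B \<in> M \<Longrightarrow> \<phi> \<in> hom K X B \<Longrightarrow> \<exists>\<psi> \<in> hom K E B. \<psi> \<cdot> \<rho> = \<phi>"
  shows "is_extension K L M X \<rho>"
proof -
  have "\<exists>!\<psi>. \<psi> \<in> hom K E B \<and> \<phi> = \<psi> \<cdot> \<rho>" if "B \<in> M" "\<phi> \<in> hom K X B" for B \<phi>
  proof -
    from assms(4)[OF that] obtain \<psi> where "\<psi> \<in> hom K E B" "\<psi> \<cdot> \<rho> = \<phi>" by blast
    then show ?thesis using epimorphismD[OF assms(1,2)] by (intro ex1I[of _ \<psi>]) auto
  qed
  moreover have "\<rho> \<in> Mor K" "Dom K \<rho> = X" "Ran K \<rho> = E" using assms(2) by (auto simp: hom_def)
  ultimately show ?thesis using assms(3) by (simp add: is_extension_def)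
qed

text \<open>Morphisms are compared after composing with test morphisms into \<open>M\<close>. Monic:
  a test morphism out of \<open>X\<close> factors through \<open>\<rho>\<close>, so it cannot
  separate what \<open>\<rho>\<close> identifies. Epic: factorizations of test morphisms through
  \<open>\<rho>\<close> are unique.\<close>

lemma extension_bimorphism:
  assumes "differs_morphisms_outside K M" "is_extension K L M X \<rho>"
  shows "bimorphism K \<rho>"
proof -
  note \<rho> = extension_hom[OF assms(2)]
  have fac: "\<exists>!\<psi>. \<psi> \<in> hom K (Ran K \<rho>) B \<and> \<phi> = \<psi> \<cdot> \<rho>" if "B \<in> M" "\<phi> \<in> hom K X B" for B \<phi>
    using assms(2) that unfolding is_extension_def by blast
  have sep: "a = b" if "a \<in> hom K A B" "b \<in> hom K A B"
    "\<And>N \<phi>. N \<in> M \<Longrightarrow> \<phi> \<in> hom K B N \<Longrightarrow> \<phi> \<cdot> a = \<phi> \<cdot> b" for a b A B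
    using assms(1) that hom_Obj[OF that(1)] unfolding differs_morphisms_outside_def by blast
  have "a = b" if ab: "a \<in> hom K A X" "b \<in> hom K A X" "\<rho> \<cdot> a = \<rho> \<cdot> b" for A a b
  proof (rule sep[OF ab(1,2)])
    fix N \<phi> assume "N \<in> M" "\<phi> \<in> hom K X N"
    then obtain \<psi> where \<psi>: "\<psi> \<in> hom K (Ran K \<rho>) N" "\<phi> = \<psi> \<cdot> \<rho>" using fac by blast
    then show "\<phi> \<cdot> a = \<phi> \<cdot> b"
      using ab(3) Cmp_assoc[OF ab(1) \<rho> \<psi>(1)] Cmp_assoc[OF ab(2) \<rho> \<psi>(1)] by simp
  qed
  moreover have "a = b"
    if ab: "a \<in> hom K (Ran K \<rho>) A" "b \<in> hom K (Ran K \<rho>) A" "a \<cdot> \<rho> = b \<cdot> \<rho>" for A a b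
  proof (rule sep[OF ab(1,2)])
    fix N \<phi> assume N: "N \<in> M" "\<phi> \<in> hom K A N"
    note c = Cmp_hom[OF ab(1) N(2)] Cmp_hom[OF ab(2) N(2)]
    have "(\<phi> \<cdot> a) \<cdot> \<rho> = (\<phi> \<cdot> b) \<cdot> \<rho>"
      using ab(3) Cmp_assoc[OF \<rho> ab(1) N(2)] Cmp_assoc[OF \<rho> ab(2) N(2)] by simp
    \<comment> \<open>Both sides factor the same morphism from \<open>X\<close> to \<open>N\<close>
      through \<open>\<rho>\<close>.\<close>
    then show "\<phi> \<cdot> a = \<phi> \<cdot> b" using fac[OF N(1) Cmp_hom[OF \<rho> c(1)]] c by blast
  qed
  ultimately show ?thesis
    using \<rho> unfolding bimorphism_def monomorphism_def epimorphism_def by (auto simp: hom_def)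
qed

text \<open>Fix one envelope \<open>e X\<close> per object. \<open>Em \<alpha>\<close> is the unique
  factorization of \<open>e Y \<cdot> \<alpha>\<close> through \<open>e X\<close>, and both functor
  laws follow by cancelling \<open>e X\<close> on the right.\<close>

lemma envelope_functor:
  assumes env: "\<And>X. X \<in> Obj K \<Longrightarrow> \<exists>\<rho>. is_envelope K L L X \<rho>"
  shows "envelope_is_functor K L L"
proof -
  obtain e where e: "is_envelope K L L X (e X)" if "X \<in> Obj K" for X
    using env by metis
  have ext: "is_extension K L L X (e X)" if "X \<in> Obj K" for X
    using e[OF that] by (simp add: is_envelope_def)
  define Eo where "Eo X = Ran K (e X)" for X
  have eh: "e X \<in> hom K X (Eo X)" if "X \<in> Obj K" for X
    using extension_hom[OF ext[OF that]] by (simp add: Eo_def)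
  have EoL: "Eo X \<in> L" if "X \<in> Obj K" for X
    using ext[OF that] by (simp add: Eo_def is_extension_def)
  have fac: "\<exists>!\<psi>. \<psi> \<in> hom K (Eo X) (Eo Y) \<and> \<phi> = \<psi> \<cdot> e X"
    if "\<phi> \<in> hom K X (Eo Y)" "X \<in> Obj K" "Y \<in> Obj K" for X Y \<phi>
    using ext[OF that(2)] EoL[OF that(3)] that(1) unfolding is_extension_def Eo_def by blast
  \<comment> \<open>Cancellation of \<open>e X\<close>, needed only against morphisms between
    envelope objects, which lie in \<open>L\<close>.\<close>
  have uniq: "a = b" if "X \<in> Obj K" "Y \<in> Obj K" "a \<in> hom K (Eo X) (Eo Y)" "b \<in> hom K (Eo X) (Eo Y)"
    "a \<cdot> e X = b \<cdot> e X" for a b X Y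
    using fac[OF Cmp_hom[OF eh[OF that(1)] that(3)] that(1,2)] that(3-5) by blast
  define Em where "Em \<alpha> = (THE \<psi>. \<psi> \<in> hom K (Eo (Dom K \<alpha>)) (Eo (Ran K \<alpha>)) \<and>
     e (Ran K \<alpha>) \<cdot> \<alpha> = \<psi> \<cdot> e (Dom K \<alpha>))" for \<alpha>
  have Em: "Em \<alpha> \<in> hom K (Eo X) (Eo Y) \<and> e Y \<cdot> \<alpha> = Em \<alpha> \<cdot> e X" if "\<alpha> \<in> hom K X Y" for X Y \<alpha>
  proof -
    have XY: "X \<in> Obj K" "Y \<in> Obj K" "Dom K \<alpha> = X" "Ran K \<alpha> = Y"
      using that hom_Obj[OF that] by (auto simp: hom_def)
    show ?thesis
      using theI'[OF fac[OF Cmp_hom[OF that eh[OF XY(2)]] XY(1,2)]] unfolding Em_def XY(3,4) .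
  qed
  have EO: "Eo X \<in> Obj K" if "X \<in> Obj K" for X
    using hom_Obj(2)[OF eh[OF that]] .
  have "Em (Ide K X) = Ide K (Eo X)" if "X \<in> Obj K" for X
  proof (rule uniq[OF that that])
    show "Em (Ide K X) \<in> hom K (Eo X) (Eo X)" using Em[OF Ide_hom[OF that]] ..
    show "Ide K (Eo X) \<in> hom K (Eo X) (Eo X)" using Ide_hom EO[OF that] .
    show "Em (Ide K X) \<cdot> e X = Ide K (Eo X) \<cdot> e X"
      using Em[OF Ide_hom[OF that]] Cmp_Ide[OF eh[OF that]] Ide_Cmp[OF eh[OF that]] by simp
  qed
  moreover have "Em (g \<cdot> f) = Em g \<cdot> Em f" if fg: "f \<in> hom K X Y" "g \<in> hom K Y Z" for f g X Y Z
  proof -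
    have O: "X \<in> Obj K" "Y \<in> Obj K" "Z \<in> Obj K" using hom_Obj fg by blast+
    note F = conjunct1[OF Em[OF fg(1)]] conjunct2[OF Em[OF fg(1)]]
      and G = conjunct1[OF Em[OF fg(2)]] conjunct2[OF Em[OF fg(2)]]
      and GF = conjunct1[OF Em[OF Cmp_hom[OF fg]]] conjunct2[OF Em[OF Cmp_hom[OF fg]]]
    have "Em (g \<cdot> f) \<cdot> e X = (e Z \<cdot> g) \<cdot> f"
      using GF(2) Cmp_assoc[OF fg eh[OF O(3)]] by simp
    also have "\<dots> = Em g \<cdot> (e Y \<cdot> f)"
      using G(2) Cmp_assoc[OF fg(1) eh[OF O(2)] G(1)] by simp
    also have "\<dots> = (Em g \<cdot> Em f) \<cdot> e X"
      using F(2) Cmp_assoc[OF eh[OF O(1)] F(1) G(1)] by simp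
    finally show ?thesis using uniq[OF O(1,3) GF(1) Cmp_hom[OF F(1) G(1)]] by simp
  qed
  ultimately have "is_functor K K Eo Em"
    unfolding is_functor_def using EO Em by blast
  then show ?thesis unfolding envelope_is_functor_def
    by (intro exI[of _ Eo] exI[of _ Em] exI[of _ e]) (simp add: eh e Em)
qed

end

section \<open>Products in \<open>L\<close> and the construction of the reflection\<close>

lemma product_in_closed_class:
  fixes K (structure)
  assumes "category K"
    and "projectively_complete mem K" "closed_under_projective_limits mem K L"
    and I: "is_set mem I"
    and f: "\<And>s. s \<in> I \<Longrightarrow> f s \<in> hom K X (F s)" and F: "\<And>s. s \<in> I \<Longrightarrow> F s \<in> L"
    and X: "X \<in> Obj K"
  obtains P h p where "P \<in> L" "h \<in> hom K X P"
    "\<forall>s\<in>I. p s \<in> hom K P (F s) \<and> p s \<cdot> h = f s"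
proof -
  interpret category K by fact
  \<comment> \<open>The product of the objects \<open>F s\<close> is the limit of this diagram,
    whose only arrows are identities.\<close>
  let ?J = "discrete_category I" and ?Fm = "\<lambda>s. Ide K (F s)"
  have J: "small_category mem ?J" using I by (rule small_discrete_category)
  note O = discrete_category_simps(1)
  have FO: "F s \<in> Obj K" if "s \<in> I" for s using f[OF that] hom_Obj by blast
  have func: "is_functor ?J K F ?Fm"
    unfolding is_functor_def using FO Ide_hom Ide_Cmp[OF Ide_hom]
    by (auto simp: discrete_category_simps hom_discrete_category)
  obtain P p where lim: "is_projective_limit ?J K F ?Fm P p"
    using assms(2) J func unfolding projectively_complete_def by blast
  have P: "P \<in> L"
    using assms(3) J func lim O F unfolding closed_under_projective_limits_def by metis
  have p: "p s \<in> hom K P (F s)" if "s \<in> I" for s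
    using lim that unfolding is_projective_limit_def is_cone_def O by blast
  \<comment> \<open>Over a discrete diagram any family is a cone. For empty \<open>I\<close> the
    family says nothing about \<open>X\<close>, so \<open>X \<in> Obj K\<close> comes from the
    assumption.\<close>
  have "is_cone ?J K F ?Fm X f"
    unfolding is_cone_def using f X Ide_Cmp[OF f] by (auto simp: O hom_discrete_category)
  then obtain h where "h \<in> hom K X P" "\<forall>s\<in>I. p s \<cdot> h = f s"
    using lim unfolding is_projective_limit_def O by blast
  then show ?thesis using that P p by blast
qed

lemma extension_exists:
  fixes K (structure)
  assumes "morse_kelley mem" "category K"
    and "projectively_complete mem K" "closed_under_projective_limits mem K L"
    and nodal: "has_nodal_decomposition K" "closed_under_nodal_images K L"
    and skel: "skeleton (epi_category K X) S" "is_set mem S"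
    and X: "X \<in> Obj K"
  shows "\<exists>\<rho>. is_extension K L L X \<rho>"
proof -
  interpret morse_kelley mem by fact
  interpret category K by fact
  let ?C = "epi_category K X"
  \<comment> \<open>Elements of \<open>S\<close> are replaced by isomorphic epimorphisms with range in \<open>L\<close>, so that closedness
      of \<open>L\<close> under isomorphisms need not be derived.\<close>
  define Q where "Q s e \<longleftrightarrow> e \<in> Obj ?C \<and> Ran K e \<in> L \<and> isomorphic ?C e s" for s e
  define f where "f s = (SOME e. Q s e)" for s
  \<comment> \<open>Only representatives with a witness are kept, so that \<open>f\<close> is
    meaningful on \<open>I\<close>; as a subclass of \<open>S\<close>, \<open>I\<close> is again a
    set.\<close>
  define I where "I = {s \<in> S. \<exists>e. Q s e}"
  have Qf: "Q s (f s)" if "s \<in> I" for s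
    using that someI_ex[of "Q s"] unfolding I_def f_def by blast
  have f: "f s \<in> hom K X (Ran K (f s))" if "s \<in> I" for s
    using Qf[OF that] by (auto simp: Q_def epi_category_def epimorphism_def hom_def)
  have FL: "Ran K (f s) \<in> L" if "s \<in> I" for s using Qf[OF that] by (simp add: Q_def)
  have I: "is_set mem I" by (rule is_set_subset[OF skel(2)]) (auto simp: I_def)
  obtain P h p where P: "P \<in> L" and h: "h \<in> hom K X P"
    and p: "\<forall>s\<in>I. p s \<in> hom K P (Ran K (f s)) \<and> p s \<cdot> h = f s"
    by (rule product_in_closed_class[OF assms(2-4) I f FL X])
  \<comment> \<open>The joint morphism \<open>h\<close> need not be epic; its epic part
    \<open>\<rho>\<close> is, and still has its range in \<open>L\<close>.\<close>
  obtain E \<rho> m where E: "E \<in> L" and \<rho>: "epimorphism K \<rho>" "\<rho> \<in> hom K X E"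
    and m: "m \<in> hom K E P" "m \<cdot> \<rho> = h"
    using nodal_epi_factorization[OF nodal h P] by blast
  have "\<exists>\<psi> \<in> hom K E B. \<psi> \<cdot> \<rho> = \<phi>" if B: "B \<in> L" "\<phi> \<in> hom K X B" for B \<phi>
  proof -
    obtain D e n where D: "D \<in> L" and e: "epimorphism K e" "e \<in> hom K X D"
      and n: "n \<in> hom K D B" "n \<cdot> e = \<phi>"
      using nodal_epi_factorization[OF nodal B(2,1)] by blast
    have RD: "Ran K e = D" using e by (simp add: hom_def)
    have eC: "e \<in> Obj ?C" using e by (simp add: epi_category_def hom_def)
    then obtain s where s: "s \<in> S" "isomorphic ?C e s"
      using skel(1) unfolding skeleton_def by blast
    \<comment> \<open>\<open>e\<close> itself is a witness for \<open>s\<close>, although the chosen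
      \<open>f s\<close> may be a different one; both are isomorphic to \<open>s\<close>.\<close>
    then have sI: "s \<in> I" using eC RD D unfolding I_def Q_def by blast
    obtain \<kappa> where \<kappa>: "\<kappa> \<in> hom K (Ran K s) D" "\<kappa> \<cdot> s = e"
      using isomorphic_epi_category_factor[OF s(2)] RD by metis
    obtain \<tau> where l: "\<tau> \<in> hom K (Ran K (f s)) (Ran K s)" "\<tau> \<cdot> f s = s"
      using isomorphic_epi_category_factor Qf[OF sI] unfolding Q_def by metis
    have b: "p s \<in> hom K P (Ran K (f s))" and ph: "p s \<cdot> h = f s" using p sI by auto
    \<comment> \<open>The factorization of \<open>\<phi>\<close> is built in stages:
      \<open>f s\<close>, then \<open>s\<close>, \<open>e\<close> and finally \<open>\<phi>\<close>
      are factored through \<open>\<rho>\<close>, composing in turn with \<open>\<tau>\<close>,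
      \<open>\<kappa>\<close> and \<open>n\<close>.\<close>
    have 1: "p s \<cdot> m \<in> hom K E (Ran K (f s))" "(p s \<cdot> m) \<cdot> \<rho> = f s"
      using Cmp_hom[OF m(1) b] Cmp_assoc[OF \<rho>(2) m(1) b] m(2) ph by simp_all
    have 2: "\<tau> \<cdot> (p s \<cdot> m) \<in> hom K E (Ran K s)" "(\<tau> \<cdot> (p s \<cdot> m)) \<cdot> \<rho> = s"
      using Cmp_hom[OF 1(1) l(1)] Cmp_assoc[OF \<rho>(2) 1(1) l(1)] 1(2) l(2) by simp_all
    have 3: "\<kappa> \<cdot> (\<tau> \<cdot> (p s \<cdot> m)) \<in> hom K E D" "(\<kappa> \<cdot> (\<tau> \<cdot> (p s \<cdot> m))) \<cdot> \<rho> = e"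
      using Cmp_hom[OF 2(1) \<kappa>(1)] Cmp_assoc[OF \<rho>(2) 2(1) \<kappa>(1)] 2(2) \<kappa>(2) by simp_all
    show ?thesis
      using Cmp_hom[OF 3(1) n(1)] Cmp_assoc[OF \<rho>(2) 3(1) n(1)] 3(2) n(2) by metis
  qed
  then have "is_extension K L L X \<rho>" using epi_is_extension \<rho> E by blast
  then show ?thesis ..
qed

theorem theorem0p1p41:
  fixes mem :: "'u \<Rightarrow> 'u \<Rightarrow> bool"
    and K :: "('u, 'u) cat"
    and L :: "'u set"
  assumes "morse_kelley mem"
    and "category K"
    and "L \<subseteq> Obj K"
    and i: "projectively_complete mem K"
    and ii: "has_nodal_decomposition K"
    and iii: "co_well_powered_in_Epi mem K"
    and iv: "\<forall>X \<in> Obj K. \<exists>\<phi> \<in> Mor K. Dom K \<phi> = X \<and> Ran K \<phi> \<in> L"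
    and v: "differs_morphisms_outside K L"
    and vi: "closed_under_projective_limits mem K L"
    and vii: "closed_under_nodal_images K L"
  shows "(\<forall>X \<in> Obj K. \<exists>\<rho>. is_envelope K L L X \<rho>) \<and>
         (\<forall>X \<in> Obj K. \<forall>\<rho>. is_envelope K L L X \<rho> \<longrightarrow> bimorphism K \<rho>) \<and>
         envelope_is_functor K L L"
proof -
  interpret category K by fact
  have ext: "\<exists>\<rho>. is_extension K L L X \<rho>" if X: "X \<in> Obj K" for X
  proof -
    obtain S where "skeleton (epi_category K X) S" "is_set mem S"
      using iii X unfolding co_well_powered_in_Epi_def by blast
    then show ?thesis using extension_exists[OF assms(1,2) i vi ii vii _ _ X] by blast
  qed
  have env: "\<exists>\<rho>. is_envelope K L L X \<rho>" if "X \<in> Obj K" for X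
    using ext[OF that] extension_is_envelope by blast
  then show ?thesis
    using extension_bimorphism[OF v] envelope_functor unfolding is_envelope_def by blast
qed

end
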